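(* Let $T$ be a binary tree with $n$ vertices and let $S$ be an $n \times n$ grid point set. Then $T$ admits a restricted RAC$_1$ embedding on $S$.
   Context: An $n \times n$ grid point set is a set $S$ of $n$ points with integer coordinates in $\{1,\dots,n\}^2$ that are in general position, i.e., no two points of $S$ lie on a common horizontal or a common vertical line. A point-set embedding of an $n$-vertex graph $G=(V,E)$ on $S$ consists of a bijection $\mu: V \to S$ and a polyline drawing of $G$ in which each vertex $v$ is drawn at $\mu(v)$ and each edge $uv$ is drawn as a polygonal chain from $\mu(u)$ to $\mu(v)$; edges may not overlap (share a segment of positive length) and may not pass through points representing vertices other than their endpoints. The drawing is RAC if any two crossing edges cross at a right angle. A restricted RAC$_b$ embedding is such an embedding in which every bend lies on a grid point (a point with integer coordinates), every edge segment lies on a grid line (is horizontal or vertical), and every edge has at most $b$ bends. The bijection $\mu$ may be chosen freely. *)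

theory Defs
  imports "HOL-Analysis.Analysis"
begin

section \<open>Finite simple graphs and binary trees\<close>

definition simple_graph :: "'a set \<Rightarrow> 'a set set \<Rightarrow> bool" where
  "simple_graph V E \<longleftrightarrow> finite V \<and> (\<forall>e\<in>E. e \<subseteq> V \<and> card e = 2)"

definition simple_path_in :: "'a set \<Rightarrow> 'a set set \<Rightarrow> 'a list \<Rightarrow> bool" where
  "simple_path_in V E p \<longleftrightarrow>
     p \<noteq> [] \<and> set p \<subseteq> V \<and> distinct p \<and> successively (\<lambda>u v. {u, v} \<in> E) p"

definition graph_connected :: "'a set \<Rightarrow> 'a set set \<Rightarrow> bool" where
  "graph_connected V E \<longleftrightarrow>
     V \<noteq> {} \<and> (\<forall>u\<in>V. \<forall>v\<in>V. \<exists>p. simple_path_in V E p \<and> hd p = u \<and> last p = v)"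

definition graph_acyclic :: "'a set \<Rightarrow> 'a set set \<Rightarrow> bool" where
  "graph_acyclic V E \<longleftrightarrow>
     \<not> (\<exists>p. simple_path_in V E p \<and> 3 \<le> length p \<and> {last p, hd p} \<in> E)"

definition graph_tree :: "'a set \<Rightarrow> 'a set set \<Rightarrow> bool" where
  "graph_tree V E \<longleftrightarrow> simple_graph V E \<and> graph_connected V E \<and> graph_acyclic V E"

text \<open>In a tree rooted at \<open>r\<close>, the children of \<open>u\<close> are the neighbours \<open>v\<close> of \<open>u\<close> such that
  the (unique) simple path from \<open>r\<close> to \<open>v\<close> visits \<open>u\<close>.\<close>

definition children :: "'a set \<Rightarrow> 'a set set \<Rightarrow> 'a \<Rightarrow> 'a \<Rightarrow> 'a set" where
  "children V E r u =
     {v \<in> V. {u, v} \<in> E \<and>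
        (\<exists>p. simple_path_in V E p \<and> hd p = r \<and> last p = v \<and> u \<in> set p)}"

definition binary_tree :: "'a set \<Rightarrow> 'a set set \<Rightarrow> 'a \<Rightarrow> bool" where
  "binary_tree V E r \<longleftrightarrow>
     graph_tree V E \<and> r \<in> V \<and> (\<forall>u\<in>V. card (children V E r u) \<le> 2)"


section \<open>Grid point sets\<close>

type_synonym point = "real \<times> real"

definition grid_point :: "point \<Rightarrow> bool" where
  "grid_point p \<longleftrightarrow> fst p \<in> \<int> \<and> snd p \<in> \<int>"

definition grid_point_set :: "nat \<Rightarrow> point set \<Rightarrow> bool" where
  "grid_point_set n S \<longleftrightarrow>
     finite S \<and> card S = n \<and>
     (\<forall>p\<in>S. grid_point p \<and> fst p \<in> {1..real n} \<and> snd p \<in> {1..real n}) \<and>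
     (\<forall>p\<in>S. \<forall>q\<in>S. p \<noteq> q \<longrightarrow> fst p \<noteq> fst q \<and> snd p \<noteq> snd q)"


section \<open>Polyline drawings\<close>

text \<open>A polygonal chain is given by the list of its corners, including its two endpoints.\<close>

definition chain_segments :: "point list \<Rightarrow> (point \<times> point) set" where
  "chain_segments ps = set (zip ps (tl ps))"

definition chain_points :: "point list \<Rightarrow> point set" where
  "chain_points ps = (\<Union>(a, b)\<in>chain_segments ps. closed_segment a b)"

text \<open>Chains are non-degenerate and do not meet themselves, i.e. they are simple arcs.\<close>

definition polygonal_chain :: "point list \<Rightarrow> bool" where
  "polygonal_chain ps \<longleftrightarrow>
     2 \<le> length ps \<and>
     (\<forall>i. Suc i < length ps \<longrightarrow> ps ! i \<noteq> ps ! Suc i) \<and>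
     (\<forall>i j. i < j \<and> Suc j < length ps \<longrightarrow>
        closed_segment (ps ! i) (ps ! Suc i) \<inter> closed_segment (ps ! j) (ps ! Suc j) =
          (if j = Suc i then {ps ! j} else {}))"

text \<open>A straight interior corner is also counted as a bend. This does not affect the existence
  of drawings with a bounded number of bends, since such corners can be removed.\<close>

definition bends :: "point list \<Rightarrow> point list" where
  "bends ps = butlast (tl ps)"

definition overlap :: "point list \<Rightarrow> point list \<Rightarrow> bool" where
  "overlap ps qs \<longleftrightarrow>
     (\<exists>a b. a \<noteq> b \<and> closed_segment a b \<subseteq> chain_points ps \<inter> chain_points qs)"

definition point_set_embedding ::
    "'a set \<Rightarrow> 'a set set \<Rightarrow> point set \<Rightarrow> ('a \<Rightarrow> point) \<Rightarrow> ('a set \<Rightarrow> point list) \<Rightarrow> bool" where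
  "point_set_embedding V E S \<mu> \<Gamma> \<longleftrightarrow>
     bij_betw \<mu> V S \<and>
     (\<forall>e\<in>E. polygonal_chain (\<Gamma> e) \<and>
        (\<exists>u v. e = {u, v} \<and> hd (\<Gamma> e) = \<mu> u \<and> last (\<Gamma> e) = \<mu> v)) \<and>
     (\<forall>e\<in>E. \<forall>w\<in>V - e. \<mu> w \<notin> chain_points (\<Gamma> e)) \<and>
     (\<forall>e\<in>E. \<forall>f\<in>E. e \<noteq> f \<longrightarrow> \<not> overlap (\<Gamma> e) (\<Gamma> f))"

text \<open>Every common point of two distinct edges, apart from the image of a common end vertex,
  counts as a crossing. If it is a bend of one of them, the right angle is required for all
  segments that contain it.\<close>

definition rac_drawing ::
    "'a set set \<Rightarrow> ('a \<Rightarrow> point) \<Rightarrow> ('a set \<Rightarrow> point list) \<Rightarrow> bool" where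
  "rac_drawing E \<mu> \<Gamma> \<longleftrightarrow>
     (\<forall>e\<in>E. \<forall>f\<in>E. e \<noteq> f \<longrightarrow>
        (\<forall>(a, b)\<in>chain_segments (\<Gamma> e). \<forall>(c, d)\<in>chain_segments (\<Gamma> f).
           closed_segment a b \<inter> closed_segment c d - \<mu> ` (e \<inter> f) \<noteq> {} \<longrightarrow>
           orthogonal (b - a) (d - c)))"

definition on_grid_line :: "point \<Rightarrow> point \<Rightarrow> bool" where
  "on_grid_line a b \<longleftrightarrow>
     (fst a = fst b \<and> fst a \<in> \<int>) \<or> (snd a = snd b \<and> snd a \<in> \<int>)"

definition restricted_RAC_embedding ::
    "nat \<Rightarrow> 'a set \<Rightarrow> 'a set set \<Rightarrow> point set \<Rightarrow> ('a \<Rightarrow> point) \<Rightarrow> ('a set \<Rightarrow> point list) \<Rightarrow> bool"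
  where
  "restricted_RAC_embedding b V E S \<mu> \<Gamma> \<longleftrightarrow>
     point_set_embedding V E S \<mu> \<Gamma> \<and>
     rac_drawing E \<mu> \<Gamma> \<and>
     (\<forall>e\<in>E.
        (\<forall>p\<in>set (bends (\<Gamma> e)). grid_point p) \<and>
        (\<forall>(p, q)\<in>chain_segments (\<Gamma> e). on_grid_line p q) \<and>
        length (bends (\<Gamma> e)) \<le> b)"

definition admits_restricted_RAC :: "nat \<Rightarrow> 'a set \<Rightarrow> 'a set set \<Rightarrow> point set \<Rightarrow> bool" where
  "admits_restricted_RAC b V E S \<longleftrightarrow> (\<exists>\<mu> \<Gamma>. restricted_RAC_embedding b V E S \<mu> \<Gamma>)"

end

theory Submission
  imports Defs
begin

text \<open>Orient every edge from parent to child and order the vertices so that every vertex has at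
  most one child before it and at most one child after it; such an order is built top-down by
  putting each new vertex first or last. Map the vertices to the points by increasing
  \<open>x\<close>-coordinate, and let every edge leave the parent horizontally and enter the child vertically.
  As no grid line contains two points, two edges can only overlap on the horizontal line of a
  common parent or on the vertical line of a common child. In the first case they leave in opposite
  directions, and the second does not occur because parents are unique.\<close>

section \<open>Simple paths and the parent relation\<close>

lemma simple_path_in_snoc:
  assumes "simple_path_in V E p" "{last p, v} \<in> E" "v \<in> V" "v \<notin> set p"
  shows "simple_path_in V E (p @ [v])"
  using assms by (auto simp: simple_path_in_def successively_append_iff)

lemma simple_path_in_prefix:
  assumes "simple_path_in V E (p @ v # q)"
  shows "simple_path_in V E (p @ [v])"
  using assms by (auto simp: simple_path_in_def successively_append_iff)

text \<open>If \<open>v\<close> already lies on \<open>p\<close>, the path is cut off at its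
  occurrence instead of being prolonged. The bound on \<open>set q\<close> lets later arguments keep
  track of avoided vertices.\<close>

lemma simple_path_in_extend:
  assumes "simple_path_in V E p" "{last p, v} \<in> E" "v \<in> V"
  shows "\<exists>q. simple_path_in V E q \<and> hd q = hd p \<and> last q = v \<and> set q \<subseteq> insert v (set p)"
proof (cases "v \<in> set p")
  case True
  then obtain p1 p2 where p: "p = p1 @ v # p2"
    by (meson split_list)
  have "simple_path_in V E (p1 @ [v])"
    using assms(1) p simple_path_in_prefix by metis
  then show ?thesis
    using p by (intro exI[of _ "p1 @ [v]"]) (auto simp: hd_append)
next
  case False
  then show ?thesis
    using simple_path_in_snoc[OF assms(1,2,3)] assms(1)
    by (intro exI[of _ "p @ [v]"]) (auto simp: simple_path_in_def)
qed

text \<open>A plain concatenation may repeat vertices, so the vertices of \<open>q\<close> are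
  attached one by one with \<open>simple_path_in_extend\<close>, which cuts back at each
  repetition.\<close>

lemma simple_path_in_trans:
  assumes "simple_path_in V E p" "simple_path_in V E q" "last p = hd q"
  shows "\<exists>s. simple_path_in V E s \<and> hd s = hd p \<and> last s = last q \<and> set s \<subseteq> set p \<union> set q"
  using assms(2,3)
proof (induction q rule: rev_induct)
  case Nil
  then show ?case by (simp add: simple_path_in_def)
next
  case (snoc v q)
  show ?case
  proof (cases "q = []")
    case True
    then show ?thesis using assms(1) snoc.prems by auto
  next
    case False
    have q: "simple_path_in V E q" "{last q, v} \<in> E" "v \<in> V"
      using snoc.prems(1) False by (auto simp: simple_path_in_def successively_append_iff)
    obtain s where s: "simple_path_in V E s" "hd s = hd p" "last s = last q"
        "set s \<subseteq> set p \<union> set q"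
      using snoc.IH[OF q(1)] snoc.prems(2) False by auto
    then show ?thesis
      using simple_path_in_extend[of V E s v] q by fastforce
  qed
qed

lemma simple_path_in_rev:
  assumes "simple_path_in V E p"
  shows "simple_path_in V E (rev p)"
  using assms by (simp add: simple_path_in_def insert_commute)

text \<open>Going from \<open>u\<close> back to \<open>r\<close> along \<open>p\<close> and on to
  \<open>w\<close> along \<open>q\<close> yields a simple path that avoids \<open>v\<close>. If
  \<open>u\<close> and \<open>w\<close> differed, \<open>v\<close> would close it to a
  cycle.\<close>

lemma acyclic_avoiding_paths_same_end:
  assumes "graph_acyclic V E" "v \<in> V" "{u, v} \<in> E" "{w, v} \<in> E"
    and p: "simple_path_in V E p" "hd p = r" "last p = u" "v \<notin> set p"
    and q: "simple_path_in V E q" "hd q = r" "last q = w" "v \<notin> set q"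
  shows "u = w"
proof (rule ccontr)
  assume "u \<noteq> w"
  have ne: "p \<noteq> []" "q \<noteq> []"
    using p q by (auto simp: simple_path_in_def)
  obtain s where s: "simple_path_in V E s" "hd s = u" "last s = w" "set s \<subseteq> set p \<union> set q"
    using simple_path_in_trans[OF simple_path_in_rev[OF p(1)] q(1)] p q ne
    by (auto simp: hd_rev last_rev)
  have "v \<notin> set s" using s p q by auto
  then have sv: "simple_path_in V E (s @ [v])"
    using simple_path_in_snoc[OF s(1)] s(3) assms by auto
  have "s \<noteq> []" using s by (simp add: simple_path_in_def)
  have "length s \<noteq> 1"
    using s(2,3) \<open>u \<noteq> w\<close> by (auto simp: length_Suc_conv)
  then have "3 \<le> length (s @ [v])"
    using \<open>s \<noteq> []\<close> by (cases s) (auto simp: neq_Nil_conv)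
  moreover have "{last (s @ [v]), hd (s @ [v])} \<in> E"
    using \<open>s \<noteq> []\<close> s(2) assms(3) by (simp add: insert_commute)
  ultimately show False
    using assms(1) sv unfolding graph_acyclic_def by blast
qed

section \<open>Depth of a vertex and uniqueness of parents\<close>

definition depth :: "'a set \<Rightarrow> 'a set set \<Rightarrow> 'a \<Rightarrow> 'a \<Rightarrow> nat" where
  "depth V E r v = (LEAST k. \<exists>p. simple_path_in V E p \<and> hd p = r \<and> last p = v \<and> length p = k)"

lemma depth_le:
  assumes "simple_path_in V E p"
  shows "depth V E (hd p) (last p) \<le> length p"
  unfolding depth_def using assms by (intro Least_le) blast

lemma depth_path:
  assumes "graph_connected V E" "r \<in> V" "v \<in> V"
  obtains p where "simple_path_in V E p" "hd p = r" "last p = v" "length p = depth V E r v"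
proof -
  have "\<exists>k p. simple_path_in V E p \<and> hd p = r \<and> last p = v \<and> length p = k"
    using assms unfolding graph_connected_def by blast
  from LeastI_ex[OF this] show thesis
    using that unfolding depth_def by blast
qed

text \<open>A shortest path to \<open>u\<close> works: if \<open>v\<close> were on it, its proper
  initial part ending in \<open>v\<close> would make \<open>v\<close> strictly shallower than
  \<open>u\<close>.\<close>

lemma depth_path_avoids:
  assumes "graph_connected V E" "r \<in> V" "u \<in> V" "u \<noteq> v" "depth V E r u \<le> depth V E r v"
  obtains p where "simple_path_in V E p" "hd p = r" "last p = u" "v \<notin> set p"
proof -
  obtain p where p: "simple_path_in V E p" "hd p = r" "last p = u" "length p = depth V E r u"
    using depth_path assms(1-3) by metis
  have "v \<notin> set p"
  proof
    assume "v \<in> set p"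
    then obtain p1 p2 where p12: "p = p1 @ v # p2" by (meson split_list)
    have "p2 \<noteq> []" using p(3) p12 assms(4) by auto
    have "simple_path_in V E (p1 @ [v])"
      using p(1) p12 simple_path_in_prefix by metis
    from depth_le[OF this] have "depth V E r v \<le> length p1 + 1"
      using p(2) p12 by (cases p1) auto
    then show False
      using assms(5) p(4) p12 \<open>p2 \<noteq> []\<close> by (cases p2) auto
  qed
  then show thesis using that p by blast
qed

text \<open>Comparing depths, rather than using paths as \<open>children\<close> does, makes the
  relation strictly increase a rank, which the induction in
  \<open>ex_order_separating_siblings\<close> relies on.\<close>

definition parent :: "'a set \<Rightarrow> 'a set set \<Rightarrow> 'a \<Rightarrow> 'a \<Rightarrow> 'a \<Rightarrow> bool" where
  "parent V E r u v \<longleftrightarrow> {u, v} \<in> E \<and> depth V E r u < depth V E r v"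

context
  fixes V :: "'a set" and E r
  assumes tree: "graph_tree V E" and root: "r \<in> V"
begin

lemma tree_facts:
  "graph_connected V E" "graph_acyclic V E" "finite V"
  "{u, v} \<in> E \<Longrightarrow> u \<in> V" "{u, v} \<in> E \<Longrightarrow> v \<in> V" "{u, v} \<in> E \<Longrightarrow> u \<noteq> v"
  using tree unfolding graph_tree_def simple_graph_def by (auto dest!: bspec)

text \<open>Shortest paths to \<open>u\<close> and \<open>w\<close> both avoid \<open>v\<close>, so
  acyclicity applies. The inequalities are non-strict so that neighbours of equal depth, excluded
  only in \<open>depth_neq\<close>, are covered.\<close>

lemma shallower_neighbour_unique:
  assumes "{u, v} \<in> E" "{w, v} \<in> E"
    and "depth V E r u \<le> depth V E r v" "depth V E r w \<le> depth V E r v"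
  shows "u = w"
proof -
  obtain p where "simple_path_in V E p" "hd p = r" "last p = u" "v \<notin> set p"
    using depth_path_avoids[OF tree_facts(1) root, of u v] assms tree_facts by metis
  moreover obtain q where "simple_path_in V E q" "hd q = r" "last q = w" "v \<notin> set q"
    using depth_path_avoids[OF tree_facts(1) root, of w v] assms tree_facts by metis
  ultimately show ?thesis
    using acyclic_avoiding_paths_same_end[OF tree_facts(2), of v u w p r q] assms tree_facts
    by metis
qed

text \<open>The predecessor of \<open>v\<close> on a shortest path is a strictly shallower
  neighbour. A neighbour \<open>u\<close> of equal depth would have to coincide with it.\<close>

lemma depth_neq:
  assumes "{u, v} \<in> E"
  shows "depth V E r u \<noteq> depth V E r v"
proof
  assume eq: "depth V E r u = depth V E r v"
  obtain p where p: "simple_path_in V E p" "hd p = r" "last p = v" "length p = depth V E r v"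
    using depth_path tree_facts(1) root assms tree_facts(5) by metis
  obtain q where q: "simple_path_in V E q" "hd q = r" "last q = u" "length q = depth V E r u"
    using depth_path tree_facts(1) root assms tree_facts(4) by metis
  have ne: "p \<noteq> []" "q \<noteq> []" using p q by (auto simp: simple_path_in_def)
  define s where "s = butlast p"
  have ps: "p = s @ [v]" using p(3) ne by (metis append_butlast_last_id s_def)
  \<comment> \<open>\<open>depth\<close> counts vertices, so the root has depth 1. If
    \<open>v\<close> were the root, \<open>u\<close> would have depth 1 too and hence be the root,
    giving a loop.\<close>
  have "s \<noteq> []"
  proof
    assume "s = []"
    then have "length p = 1" "v = r" using ps p(2) by auto
    then have "length q = 1" using eq p q by simp
    then have "u = r" using q by (auto simp: length_Suc_conv)
    with \<open>v = r\<close> show False using assms tree_facts(6) by blast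
  qed
  then have s: "simple_path_in V E s" "{last s, v} \<in> E" "hd s = r"
    using p ps by (auto simp: simple_path_in_def successively_append_iff)
  have d: "depth V E r (last s) < depth V E r v"
    using depth_le[OF s(1)] s(3) ps p(4) by simp
  then have "last s = u"
    using shallower_neighbour_unique[OF s(2) assms] eq by simp
  with d eq show False by simp
qed

lemma parent_cases: "{u, v} \<in> E \<Longrightarrow> parent V E r u v \<or> parent V E r v u"
  using depth_neq[of u v] by (auto simp: parent_def insert_commute)

lemma parent_unique: "parent V E r u v \<Longrightarrow> parent V E r w v \<Longrightarrow> u = w"
  using shallower_neighbour_unique[of u v w] by (auto simp: parent_def)

text \<open>Transfers the bound on \<open>children\<close> to \<open>parent\<close>: a shortest path
  to \<open>u\<close> avoids \<open>v\<close>, and appending \<open>v\<close> gives the path that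
  \<open>children\<close> asks for.\<close>

lemma parent_imp_children:
  assumes "parent V E r u v"
  shows "v \<in> children V E r u"
proof -
  have e: "{u, v} \<in> E" "depth V E r u \<le> depth V E r v" using assms by (auto simp: parent_def)
  obtain p where p: "simple_path_in V E p" "hd p = r" "last p = u" "v \<notin> set p"
    using depth_path_avoids[OF tree_facts(1) root, of u v] e tree_facts by metis
  have ne: "p \<noteq> []" using p by (simp add: simple_path_in_def)
  have "simple_path_in V E (p @ [v])"
    using simple_path_in_snoc[OF p(1)] p e tree_facts(5) by auto
  moreover have "u \<in> set (p @ [v])" using p(3) ne by auto
  ultimately show ?thesis
    unfolding children_def using e tree_facts(5) p(2) ne
    by (auto intro!: exI[of _ "p @ [v]"])
qed

end

section \<open>Ordering the vertices\<close>

text \<open>Vertices are added by non-decreasing \<open>d\<close>, so a new vertex has no child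
  among those present and, by \<open>R_binary\<close>, at most one sibling there. An extreme
  position on the side of the parent away from that sibling is always free.\<close>

lemma ex_order_separating_siblings:
  fixes R :: "'a \<Rightarrow> 'a \<Rightarrow> bool" and d :: "'a \<Rightarrow> nat"
  assumes "finite V"
    and R_depth: "\<And>u v. R u v \<Longrightarrow> d u < d v"
    and R_unique: "\<And>u v w. R u v \<Longrightarrow> R w v \<Longrightarrow> u = w"
    and R_binary: "\<And>u x v w. \<lbrakk>R u x; R u v; R u w; x \<noteq> v; x \<noteq> w\<rbrakk> \<Longrightarrow> v = w"
  shows "\<exists>f :: 'a \<Rightarrow> real. inj_on f V \<and>
    (\<forall>u\<in>V. \<forall>v\<in>V. \<forall>w\<in>V. R u v \<and> R u w \<and> v \<noteq> w \<longrightarrow> (f v < f u) \<noteq> (f w < f u))"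
  using \<open>finite V\<close>
proof (induction rule: finite_ranking_induct[where f = d])
  case empty
  then show ?case by simp
next
  case (insert x S)
  obtain f :: "'a \<Rightarrow> real" where f: "inj_on f S"
    and sep: "\<And>u v w. \<lbrakk>u \<in> S; v \<in> S; w \<in> S; R u v; R u w; v \<noteq> w\<rbrakk> \<Longrightarrow> (f v < f u) \<noteq> (f w < f u)"
    using insert.IH by (elim exE conjE) metis
  show ?case
  proof (cases "x \<in> S")
    case True
    then show ?thesis using insert.IH by (simp add: insert_absorb)
  next
    case False
    obtain b where b: "\<And>y. y \<in> S \<Longrightarrow> \<bar>f y\<bar> < b"
    proof -
      have "bounded (f ` S)" using insert.hyps by (simp add: finite_imp_bounded)
      then obtain b where "\<forall>y\<in>f ` S. \<bar>y\<bar> \<le> b" by (auto simp: bounded_iff)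
      then show thesis by (intro that[of "b + 1"]) force
    qed
    \<comment> \<open>All old values lie strictly between \<open>- b\<close> and \<open>b\<close>.
      The new vertex goes last if a sibling precedes the common parent, and first otherwise, also
      when no sibling or parent is present.\<close>
    define c where "c = (if \<exists>u\<in>S. \<exists>v\<in>S. R u x \<and> R u v \<and> f v < f u then b else - b)"
    have c_new: "c \<noteq> f y" if "y \<in> S" for y using b[OF that] by (auto simp: c_def)
    have below: "c < f y \<longleftrightarrow> c = - b" if "y \<in> S" for y using b[OF that] by (auto simp: c_def)
    have new_sib: "(c < f u) \<noteq> (f w < f u)" if "u \<in> S" "w \<in> S" "R u x" "R u w" for u w
    proof (cases "f w < f u")
      case True
      then have "c = b" using that by (auto simp: c_def)
      then show ?thesis using True b[OF \<open>u \<in> S\<close>] by auto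
    next
      case False
      \<comment> \<open>The parent of \<open>x\<close> and its sibling in \<open>S\<close> are
        unique, so no other pair can trigger the first case in the definition of
        \<open>c\<close>.\<close>
      have "\<not> f v < f y" if "y \<in> S" "v \<in> S" "R y x" "R y v" for y v
      proof -
        have "y = u" using R_unique that \<open>R u x\<close> by blast
        moreover have "v = w"
          using R_binary[of u x v w] that \<open>y = u\<close> \<open>R u x\<close> \<open>R u w\<close> \<open>x \<notin> S\<close> \<open>w \<in> S\<close> by blast
        ultimately show ?thesis using False by simp
      qed
      then have "c = - b" by (auto simp: c_def)
      then show ?thesis using False below[OF \<open>u \<in> S\<close>] by simp
    qed
    \<comment> \<open>Vertices in \<open>S\<close> may be as deep as \<open>x\<close> but not
      deeper, whereas a child is strictly deeper.\<close>
    have childless: "\<not> R x v" if "v \<in> insert x S" for v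
      using R_depth[of x v] insert.hyps(2)[of v] that by fastforce
    have "inj_on (f(x := c)) (insert x S)"
      using f False c_new by (auto simp: inj_on_def)
    moreover have "((f(x := c)) v < (f(x := c)) u) \<noteq> ((f(x := c)) w < (f(x := c)) u)"
      if "u \<in> insert x S" "v \<in> insert x S" "w \<in> insert x S" "R u v" "R u w" "v \<noteq> w" for u v w
    proof -
      have u: "u \<in> S" "u \<noteq> x" using childless that False by auto
      show ?thesis
        using that u new_sib[of u v] new_sib[of u w] sep[of u v w]
        by (cases "v = x"; cases "w = x") auto
    qed
    ultimately show ?thesis by blast
  qed
qed

text \<open>By induction on the cardinality, matching an element of maximal \<open>f\<close> with
  one of maximal \<open>g\<close> and removing both.\<close>

lemma ex_bij_betw_order_preserving:
  fixes f :: "'a \<Rightarrow> 'c::linorder" and g :: "'b \<Rightarrow> 'd::linorder"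
  assumes "finite A" "finite B" "card A = card B" "inj_on f A" "inj_on g B"
  shows "\<exists>h. bij_betw h A B \<and> (\<forall>x\<in>A. \<forall>y\<in>A. f x < f y \<longrightarrow> g (h x) < g (h y))"
  using assms
proof (induction "card A" arbitrary: A B)
  case 0
  then show ?case by (auto simp: bij_betw_def)
next
  case (Suc n)
  have ne: "A \<noteq> {}" "B \<noteq> {}" using Suc.hyps(2) Suc.prems by auto
  have "\<exists>a\<in>A. \<forall>x\<in>A. f x \<le> f a"
    using ne Suc.prems(1) Max_in[of "f ` A"] Max_ge[of "f ` A"] by fastforce
  then obtain a where a: "a \<in> A" "\<And>x. x \<in> A \<Longrightarrow> f x \<le> f a" by blast
  have "\<exists>b\<in>B. \<forall>x\<in>B. g x \<le> g b"
    using ne Suc.prems(2) Max_in[of "g ` B"] Max_ge[of "g ` B"] by fastforce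
  then obtain b where b: "b \<in> B" "\<And>x. x \<in> B \<Longrightarrow> g x \<le> g b" by blast
  have "\<exists>h. bij_betw h (A - {a}) (B - {b}) \<and>
      (\<forall>x\<in>A - {a}. \<forall>y\<in>A - {a}. f x < f y \<longrightarrow> g (h x) < g (h y))"
    using Suc.hyps(2) Suc.prems a b by (intro Suc.hyps(1)) (auto intro: inj_on_diff)
  then obtain h where h: "bij_betw h (A - {a}) (B - {b})"
    "\<And>x y. x \<in> A - {a} \<Longrightarrow> y \<in> A - {a} \<Longrightarrow> f x < f y \<Longrightarrow> g (h x) < g (h y)" by blast
  have "bij_betw (h(a := b)) (insert a (A - {a})) (insert b (B - {b}))"
    using h(1) by (auto simp: bij_betw_def inj_on_def)
  then have "bij_betw (h(a := b)) A B" using a b by (simp add: insert_absorb)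
  moreover have "g ((h(a := b)) x) < g ((h(a := b)) y)" if "x \<in> A" "y \<in> A" "f x < f y" for x y
  proof -
    have "x \<noteq> a" using a(2)[OF \<open>y \<in> A\<close>] that by auto
    then have "h x \<in> B - {b}" using h(1) \<open>x \<in> A\<close> by (auto simp: bij_betw_def)
    then have "g (h x) < g b"
      using b Suc.prems(5) by (metis DiffD1 DiffD2 inj_onD insertI1 order_le_less)
    then show ?thesis using h(2)[of x y] that \<open>x \<noteq> a\<close> by auto
  qed
  ultimately show ?case by blast
qed

section \<open>Edges with one bend\<close>

text \<open>The argument order matters: \<open>corner b a\<close> is the opposite corner of the
  rectangle spanned by \<open>a\<close> and \<open>b\<close>. The parent is always passed
  first.\<close>

definition corner :: "point \<Rightarrow> point \<Rightarrow> point" where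
  "corner a b = (fst b, snd a)"

definition hv_chain :: "point \<Rightarrow> point \<Rightarrow> point list" where
  "hv_chain a b = [a, corner a b, b]"

lemma mem_horizontal_part:
  "z \<in> closed_segment a (corner a b) \<longleftrightarrow>
     snd z = snd a \<and> fst z \<in> closed_segment (fst a) (fst b)"
  by (cases a; cases b; cases z) (auto simp: corner_def closed_segment_def algebra_simps)

lemma mem_vertical_part:
  "z \<in> closed_segment (corner a b) b \<longleftrightarrow>
     fst z = fst b \<and> snd z \<in> closed_segment (snd a) (snd b)"
  by (cases a; cases b; cases z) (auto simp: corner_def closed_segment_def algebra_simps)

lemma chain_segments_hv_chain: "chain_segments (hv_chain a b) = {(a, corner a b), (corner a b, b)}"
  by (simp add: chain_segments_def hv_chain_def)

lemma chain_points_hv_chain: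
  "chain_points (hv_chain a b) = closed_segment a (corner a b) \<union> closed_segment (corner a b) b"
  by (simp add: chain_points_def chain_segments_hv_chain)

lemma polygonal_chain_hv_chain:
  assumes "fst a \<noteq> fst b" "snd a \<noteq> snd b"
  shows "polygonal_chain (hv_chain a b)"
proof -
  have "closed_segment a (corner a b) \<inter> closed_segment (corner a b) b = {corner a b}"
    unfolding set_eq_iff Int_iff mem_horizontal_part mem_vertical_part
    by (auto simp: corner_def prod_eq_iff)
  moreover have "a \<noteq> corner a b" "corner a b \<noteq> b"
    using assms by (auto simp: corner_def prod_eq_iff)
  ultimately show ?thesis
    unfolding polygonal_chain_def hv_chain_def
    by (auto simp: less_Suc_eq nth_Cons split: nat.splits)
qed

text \<open>Exactly one of \<open>b\<close>, \<open>c\<close> lies left of \<open>a\<close>, so the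
  two intervals lie on different sides of their common end \<open>a\<close>. The other one may equal
  \<open>a\<close>, its interval then being a single point.\<close>

lemma closed_segments_opposite_sides:
  fixes a b c t :: real
  assumes "(b < a) \<noteq> (c < a)" "t \<in> closed_segment a b" "t \<in> closed_segment a c"
  shows "t = a"
  using assms by (auto simp: closed_segment_eq_real_ivl split: if_splits)

section \<open>Construction and verification of the drawing\<close>

theorem theorem1:
  fixes V :: "'a set" and E :: "'a set set" and r :: 'a
    and n :: nat and S :: "(real \<times> real) set"
  assumes "binary_tree V E r"
    and "card V = n"
    and "grid_point_set n S"
  shows "admits_restricted_RAC 1 V E S"
proof -
  have tree: "graph_tree V E" "r \<in> V" and ch: "\<And>u. u \<in> V \<Longrightarrow> card (children V E r u) \<le> 2"
    using assms(1) by (auto simp: binary_tree_def)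
  note tf = tree_facts[OF tree]
  let ?P = "parent V E r"
  have PV: "u \<in> V" "v \<in> V" "u \<noteq> v" "{u, v} \<in> E" if "?P u v" for u v
    using that tf(4-6) by (auto simp: parent_def)
  have P_binary: "v = w" if "?P u x" "?P u v" "?P u w" "x \<noteq> v" "x \<noteq> w" for u x v w
  proof (rule ccontr)
    assume "v \<noteq> w"
    then have "card {x, v, w} = 3" using that by simp
    moreover have "{x, v, w} \<subseteq> children V E r u"
      using parent_imp_children[OF tree] that by auto
    moreover have "finite (children V E r u)" using tf(3) by (simp add: children_def)
    ultimately have "3 \<le> card (children V E r u)" by (metis card_mono)
    then show False using ch[OF PV(1)[OF that(1)]] by simp
  qed
  have "\<exists>f :: 'a \<Rightarrow> real. inj_on f V \<and>
      (\<forall>u\<in>V. \<forall>v\<in>V. \<forall>w\<in>V. ?P u v \<and> ?P u w \<and> v \<noteq> w \<longrightarrow> (f v < f u) \<noteq> (f w < f u))"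
    using P_binary
    by (intro ex_order_separating_siblings[OF tf(3) _ parent_unique[OF tree],
        where d = "depth V E r"]) (simp add: parent_def, assumption+)
  then obtain f :: "'a \<Rightarrow> real" where f: "inj_on f V"
    and sep: "\<And>u v w. ?P u v \<Longrightarrow> ?P u w \<Longrightarrow> v \<noteq> w \<Longrightarrow> (f v < f u) \<noteq> (f w < f u)"
    using PV by metis
  have S: "finite S" "card S = n" "\<And>p. p \<in> S \<Longrightarrow> fst p \<in> \<int> \<and> snd p \<in> \<int>"
    and S_inj: "inj_on fst S" "inj_on snd S"
    using assms(3) by (auto simp: grid_point_set_def grid_point_def inj_on_def)
  \<comment> \<open>Only the order of the x-coordinates is prescribed, by \<open>f\<close>; the
    y-coordinates are whatever \<open>S\<close> dictates.\<close>
  obtain \<mu> where \<mu>: "bij_betw \<mu> V S"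
    and mono: "\<And>x y. x \<in> V \<Longrightarrow> y \<in> V \<Longrightarrow> f x < f y \<Longrightarrow> fst (\<mu> x) < fst (\<mu> y)"
    using ex_bij_betw_order_preserving[OF tf(3) S(1) _ f S_inj(1)] assms(2) S(2) by auto
  have \<mu>S: "\<mu> v \<in> S" if "v \<in> V" for v using \<mu> that by (auto simp: bij_betw_def)
  have \<mu>_fst: "fst (\<mu> v) = fst (\<mu> w) \<longleftrightarrow> v = w" and \<mu>_snd: "snd (\<mu> v) = snd (\<mu> w) \<longleftrightarrow> v = w"
    if "v \<in> V" "w \<in> V" for v w
    using that \<mu>S inj_on_eq_iff[OF S_inj(1)] inj_on_eq_iff[OF S_inj(2)]
      inj_on_eq_iff[OF bij_betw_imp_inj_on[OF \<mu>]] by simp_all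
  have \<mu>_less: "fst (\<mu> x) < fst (\<mu> y) \<longleftrightarrow> f x < f y" if "x \<in> V" "y \<in> V" for x y
    using mono[of x y] mono[of y x] that f
    by (metis inj_onD less_irrefl linorder_neqE not_less_iff_gr_or_eq)
  \<comment> \<open>Edges are unordered pairs. The choice recovers the orientation from parent to
    child, which is unique because depth strictly increases along it.\<close>
  define \<Gamma> where "\<Gamma> e = (let (u, v) = SOME (u, v). e = {u, v} \<and> ?P u v in hv_chain (\<mu> u) (\<mu> v))" for e
  have \<Gamma>: "\<Gamma> {u, v} = hv_chain (\<mu> u) (\<mu> v)" if "?P u v" for u v
  proof -
    have "(SOME (u', v'). {u, v} = {u', v'} \<and> ?P u' v') = (u, v)"
      using that by (intro some_equality) (auto simp: doubleton_eq_iff parent_def)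
    then show ?thesis by (simp add: \<Gamma>_def)
  qed
  have edge: "\<exists>u v. e = {u, v} \<and> ?P u v" if "e \<in> E" for e
  proof -
    have "card e = 2" using that tree(1) by (auto simp: graph_tree_def simple_graph_def)
    then obtain u v where "e = {u, v}" by (auto simp: card_2_iff)
    then show ?thesis using parent_cases[OF tree, of u v] that by (metis insert_commute)
  qed
  let ?h = "\<lambda>u v. closed_segment (\<mu> u) (corner (\<mu> u) (\<mu> v))"
  let ?v = "\<lambda>u v. closed_segment (corner (\<mu> u) (\<mu> v)) (\<mu> v)"
  \<comment> \<open>Horizontal parts on one line belong to the same parent. The two children lie on
    opposite sides of it, so only the point of the parent is shared.\<close>
  have hh: "?h u v \<inter> ?h u' v' \<subseteq> \<mu> ` ({u, v} \<inter> {u', v'})"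
    if "?P u v" "?P u' v'" "{u, v} \<noteq> {u', v'}" for u v u' v'
  proof
    fix z assume "z \<in> ?h u v \<inter> ?h u' v'"
    then have z: "snd z = snd (\<mu> u)" "snd z = snd (\<mu> u')"
      "fst z \<in> closed_segment (fst (\<mu> u)) (fst (\<mu> v))"
      "fst z \<in> closed_segment (fst (\<mu> u')) (fst (\<mu> v'))"
      by (simp_all add: mem_horizontal_part)
    have [simp]: "u' = u" using z(1,2) \<mu>_snd PV(1) that by metis
    have "v \<noteq> v'" using that by auto
    then have "(f v < f u) \<noteq> (f v' < f u)" using sep[of u v v'] that(1,2) by simp
    then have "(fst (\<mu> v) < fst (\<mu> u)) \<noteq> (fst (\<mu> v') < fst (\<mu> u))"
      using \<mu>_less PV(1,2)[OF that(1)] PV(2)[OF that(2)] by simp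
    then have "fst z = fst (\<mu> u)"
      using closed_segments_opposite_sides z(3,4) by simp
    with z(1) have "z = \<mu> u" by (simp add: prod_eq_iff)
    then show "z \<in> \<mu> ` ({u, v} \<inter> {u', v'})" by simp
  qed
  \<comment> \<open>Vertical parts on one line would enter the same child, which has only one
    parent, so the edges would be equal.\<close>
  have vv: "?v u v \<inter> ?v u' v' = {}"
    if "?P u v" "?P u' v'" "{u, v} \<noteq> {u', v'}" for u v u' v'
  proof (rule ccontr)
    assume "?v u v \<inter> ?v u' v' \<noteq> {}"
    then have "fst (\<mu> v) = fst (\<mu> v')" by (auto simp: mem_vertical_part)
    then have "v = v'" using \<mu>_fst PV(2) that by blast
    then show False using that parent_unique[OF tree] by blast
  qed
  have hv: "?h u v \<inter> ?v u' v' \<subseteq> {corner (\<mu> u) (\<mu> v')}" for u v u' v'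
    unfolding subset_iff Int_iff mem_horizontal_part mem_vertical_part
    by (simp add: corner_def prod_eq_iff)

  have chains: "polygonal_chain (\<Gamma> e) \<and> (\<exists>u v. e = {u, v} \<and> hd (\<Gamma> e) = \<mu> u \<and> last (\<Gamma> e) = \<mu> v)"
    if "e \<in> E" for e
  proof -
    obtain u v where e: "e = {u, v}" "?P u v" using edge \<open>e \<in> E\<close> by blast
    have "polygonal_chain (\<Gamma> e)"
      using e \<Gamma> PV[OF e(2)] \<mu>_fst \<mu>_snd by (simp add: polygonal_chain_hv_chain)
    moreover have "hd (\<Gamma> e) = \<mu> u" "last (\<Gamma> e) = \<mu> v"
      using e \<Gamma> by (simp_all add: hv_chain_def)
    ultimately show ?thesis using e(1) by blast
  qed
  \<comment> \<open>A vertex on the horizontal part shares its y-coordinate with \<open>u\<close>,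
    one on the vertical part its x-coordinate with \<open>v\<close>; general position makes it that
    end vertex.\<close>
  have vertices: "\<mu> w \<notin> chain_points (\<Gamma> e)" if "e \<in> E" "w \<in> V - e" for e w
  proof -
    obtain u v where e: "e = {u, v}" "?P u v" using edge \<open>e \<in> E\<close> by blast
    show ?thesis
      using that e \<Gamma> PV[OF e(2)] \<mu>_fst[of w v] \<mu>_snd[of w u]
      by (auto simp: chain_points_hv_chain mem_horizontal_part mem_vertical_part)
  qed
  have no_overlap: "\<not> overlap (\<Gamma> e) (\<Gamma> e')" if "e \<in> E" "e' \<in> E" "e \<noteq> e'" for e e'
  proof -
    obtain u v where e: "e = {u, v}" "?P u v" using edge \<open>e \<in> E\<close> by blast
    obtain u' v' where e': "e' = {u', v'}" "?P u' v'" using edge \<open>e' \<in> E\<close> by blast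
    have ne: "{u, v} \<noteq> {u', v'}" using that e e' by simp
    \<comment> \<open>Two edges share only finitely many points, whereas a segment with distinct
      ends is infinite.\<close>
    have "chain_points (\<Gamma> e) \<inter> chain_points (\<Gamma> e') \<subseteq>
        \<mu> ` ({u, v} \<inter> {u', v'}) \<union> {corner (\<mu> u) (\<mu> v'), corner (\<mu> u') (\<mu> v)}"
      using hh[OF e(2) e'(2) ne] vv[OF e(2) e'(2) ne] hv[of u v u' v'] hv[of u' v' u v] e e' \<Gamma>
      unfolding chain_points_hv_chain by (simp add: chain_points_hv_chain) blast
    then have "finite (chain_points (\<Gamma> e) \<inter> chain_points (\<Gamma> e'))"
      by (rule finite_subset) simp
    then show ?thesis
      unfolding overlap_def by (metis finite_closed_segment finite_subset)
  qed
  have rac: "orthogonal (b - a) (d - c)"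
    if E: "e \<in> E" "e' \<in> E" "e \<noteq> e'"
      and seg: "(a, b) \<in> chain_segments (\<Gamma> e)" "(c, d) \<in> chain_segments (\<Gamma> e')"
      and meet: "closed_segment a b \<inter> closed_segment c d - \<mu> ` (e \<inter> e') \<noteq> {}"
    for e e' a b c d
  proof -
    obtain u v where e: "e = {u, v}" "?P u v" using edge E(1) by blast
    obtain u' v' where e': "e' = {u', v'}" "?P u' v'" using edge E(2) by blast
    have ne: "{u, v} \<noteq> {u', v'}" using E e e' by simp
    have "(a, b) = (\<mu> u, corner (\<mu> u) (\<mu> v)) \<or> (a, b) = (corner (\<mu> u) (\<mu> v), \<mu> v)"
      "(c, d) = (\<mu> u', corner (\<mu> u') (\<mu> v')) \<or> (c, d) = (corner (\<mu> u') (\<mu> v'), \<mu> v')"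
      using seg e e' \<Gamma> by (simp_all add: chain_segments_hv_chain)
    \<comment> \<open>By \<open>hh\<close> and \<open>vv\<close>, parallel parts never meet outside
      common end vertices. The remaining pairs are one horizontal and one vertical part.\<close>
    then show ?thesis
      using hh[OF e(2) e'(2) ne] vv[OF e(2) e'(2) ne] meet e(1) e'(1)
      by (auto simp: orthogonal_def corner_def inner_prod_def)
  qed
  have grid: "(\<forall>p\<in>set (bends (\<Gamma> e)). grid_point p) \<and>
      (\<forall>(p, q)\<in>chain_segments (\<Gamma> e). on_grid_line p q) \<and> length (bends (\<Gamma> e)) \<le> 1"
    if "e \<in> E" for e
  proof -
    obtain u v where e: "e = {u, v}" "?P u v" using edge \<open>e \<in> E\<close> by blast
    have "\<Gamma> e = hv_chain (\<mu> u) (\<mu> v)" using e \<Gamma> by simp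
    moreover have "bends (hv_chain (\<mu> u) (\<mu> v)) = [corner (\<mu> u) (\<mu> v)]"
      by (simp add: bends_def hv_chain_def)
    ultimately show ?thesis
      \<comment> \<open>The bend takes each of its coordinates from a point of \<open>S\<close>, so
        both are integers.\<close>
      using S(3)[OF \<mu>S[OF PV(1)[OF e(2)]]] S(3)[OF \<mu>S[OF PV(2)[OF e(2)]]]
      by (simp add: chain_segments_hv_chain grid_point_def on_grid_line_def corner_def)
  qed
  have "point_set_embedding V E S \<mu> \<Gamma>"
    unfolding point_set_embedding_def using \<mu> chains vertices no_overlap by simp
  moreover have "rac_drawing E \<mu> \<Gamma>"
    unfolding rac_drawing_def
  proof (intro ballI impI, clarify)
    fix e e' a1 a2 b1 b2 c1 c2 d1 d2
    assume "e \<in> E" "e' \<in> E" "e \<noteq> e'"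
      and "((a1, a2), (b1, b2)) \<in> chain_segments (\<Gamma> e)"
      and "((c1, c2), (d1, d2)) \<in> chain_segments (\<Gamma> e')"
      and "closed_segment (a1, a2) (b1, b2) \<inter> closed_segment (c1, c2) (d1, d2) - \<mu> ` (e \<inter> e') \<noteq> {}"
    then show "orthogonal ((b1, b2) - (a1, a2)) ((d1, d2) - (c1, c2))"
      by (rule rac)
  qed
  ultimately have "restricted_RAC_embedding 1 V E S \<mu> \<Gamma>"
    unfolding restricted_RAC_embedding_def using grid by blast
  then show ?thesis
    unfolding admits_restricted_RAC_def by blast
qed

end
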